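(* Let $q\in(0,1)$ and let $J_q(\,\cdot\,)=J_q(\,\cdot\,;a_{(J)},b)$ be any one of the three $q$-integrals $G_q(\,\cdot\,;bq^n,b)$, $I_q(\,\cdot\,;0,b)$, $R_q(\,\cdot\,;a,b)$ described in the context, with interval of integration $E_{(J)}=[a_{(J)},b]$. Let $f,g:E_{(J)}\to\mathbb{R}$ be two real functions and let $\alpha,\beta>1$ be numbers satisfying $\frac1\alpha+\frac1\beta=1$. Assume that all $q$-integrals appearing below exist. Then the following inequalities hold: (i) $\displaystyle \frac1\alpha J_q(|f|^\alpha)J_q(|g|^2)+\frac1\beta J_q(|f|^2)J_q(|g|^\beta)\ge J_q(|fg|)\,J_q(|f|^{2/\beta}|g|^{2/\alpha}),$ (ii) $\displaystyle \frac1\alpha J_q(|f|^2)J_q(|g|^\beta)+\frac1\beta J_q(|f|^\alpha)J_q(|g|^2)\ge J_q(|f|^{2/\alpha}|g|^{2/\beta})\,J_q(|f|^{\alpha-1}|g|^{\beta-1}),$ (iii) $\displaystyle J_q(|f|^2)\,J_q\Bigl(\frac1\alpha|g|^\alpha+\frac1\beta|g|^\beta\Bigr)\ge J_q(|f|^{2/\alpha}|g|)\,J_q(|f|^{2/\beta}|g|).$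
   Context: Let $q\in(0,1)$. The three types of $q$-integral are: (G) restricted $q$-integral: for $b>0$, a positive integer $n$ and $a=bq^n$, $G_q(h;a,b)=b(1-q)\sum_{k=0}^{n-1}h(bq^k)q^k$; here $a_{(J)}=bq^n$. (I) for $b>0$, $I_q(h;0,b)=b(1-q)\sum_{k=0}^{\infty}h(bq^k)q^k$; here $a_{(J)}=0$. (R) Riemann-type $q$-integral: for $0<a<b$, $R_q(h;a,b)=(b-a)(1-q)\sum_{k=0}^{\infty}h\bigl(a+(b-a)q^k\bigr)q^k$; here $a_{(J)}=a$. In each case $E_{(J)}=[a_{(J)},b]$. A $q$-integral of type (I) or (R) is said to exist if the defining series converges (type (G) always exists). *)

theory Defs
  imports Complex_Main
begin

definition G_q :: "real \<Rightarrow> nat \<Rightarrow> real \<Rightarrow> (real \<Rightarrow> real) \<Rightarrow> real" where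
  "G_q q n b h = b * (1 - q) * (\<Sum>k<n. h (b * q ^ k) * q ^ k)"

definition I_q :: "real \<Rightarrow> real \<Rightarrow> (real \<Rightarrow> real) \<Rightarrow> real" where
  "I_q q b h = b * (1 - q) * (\<Sum>k. h (b * q ^ k) * q ^ k)"

definition R_q :: "real \<Rightarrow> real \<Rightarrow> real \<Rightarrow> (real \<Rightarrow> real) \<Rightarrow> real" where
  "R_q q a b h = (b - a) * (1 - q) * (\<Sum>k. h (a + (b - a) * q ^ k) * q ^ k)"

text \<open>The three kinds (G), (I), (R) of q-integral. A kind carries what is needed, besides \<open>q\<close>
  and the upper endpoint \<open>b\<close>, to determine the lower endpoint.\<close>

datatype qint_kind = Restricted nat | Jackson | Riemann real

fun lower_end :: "real \<Rightarrow> real \<Rightarrow> qint_kind \<Rightarrow> real" where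
  "lower_end q b (Restricted n) = b * q ^ n"
| "lower_end q b Jackson = 0"
| "lower_end q b (Riemann a) = a"

definition E_interval :: "real \<Rightarrow> real \<Rightarrow> qint_kind \<Rightarrow> real set" where
  "E_interval q b J = {lower_end q b J .. b}"

fun admissible :: "real \<Rightarrow> qint_kind \<Rightarrow> bool" where
  "admissible b (Restricted n) \<longleftrightarrow> 0 < b \<and> 0 < n"
| "admissible b Jackson \<longleftrightarrow> 0 < b"
| "admissible b (Riemann a) \<longleftrightarrow> 0 < a \<and> a < b"

fun J_q :: "real \<Rightarrow> real \<Rightarrow> qint_kind \<Rightarrow> (real \<Rightarrow> real) \<Rightarrow> real" where
  "J_q q b (Restricted n) h = G_q q n b h"
| "J_q q b Jackson h = I_q q b h"
| "J_q q b (Riemann a) h = R_q q a b h"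

fun qint_exists :: "real \<Rightarrow> real \<Rightarrow> qint_kind \<Rightarrow> (real \<Rightarrow> real) \<Rightarrow> bool" where
  "qint_exists q b (Restricted n) h \<longleftrightarrow> True"
| "qint_exists q b Jackson h \<longleftrightarrow> summable (\<lambda>k. h (b * q ^ k) * q ^ k)"
| "qint_exists q b (Riemann a) h \<longleftrightarrow> summable (\<lambda>k. h (a + (b - a) * q ^ k) * q ^ k)"

text \<open>Functions on the interval of integration are represented by total functions on the reals.
  This is harmless: all nodes lie in the interval, so the values of the q-integrals
  and their existence depend only on the restriction to it.\<close>

lemma
  assumes "0 < q" "q < 1" "admissible b J"
    and eq: "\<And>x. x \<in> E_interval q b J \<Longrightarrow> h x = h' x"
  shows J_q_cong_interval: "J_q q b J h = J_q q b J h'"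
    and qint_exists_cong_interval: "qint_exists q b J h \<longleftrightarrow> qint_exists q b J h'"
proof -
  have q1: "q ^ k \<le> 1" "0 < q ^ k" for k
    using assms(1,2) by (auto intro: power_le_one)
  have G: "h (b * q ^ k) = h' (b * q ^ k)" if "J = Restricted n" "k < n" for n k
  proof (rule eq)
    have "q ^ n \<le> q ^ k" using assms(1,2) that(2) by (intro power_decreasing) auto
    then show "b * q ^ k \<in> E_interval q b J"
      using assms(3) that q1[of k] by (auto simp: E_interval_def)
  qed
  have I: "h (b * q ^ k) = h' (b * q ^ k)" if "J = Jackson" for k
    using assms(3) that q1[of k] by (intro eq) (auto simp: E_interval_def)
  have R: "h (a + (b - a) * q ^ k) = h' (a + (b - a) * q ^ k)" if "J = Riemann a" for a k
  proof (rule eq)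
    have "(b - a) * q ^ k \<le> (b - a) * 1" "0 \<le> (b - a) * q ^ k"
      using assms(3) that q1[of k] by (auto intro!: mult_left_mono)
    then show "a + (b - a) * q ^ k \<in> E_interval q b J"
      using that by (auto simp: E_interval_def)
  qed
  show "J_q q b J h = J_q q b J h'"
    using G I R by (cases J) (auto simp: G_q_def I_q_def R_q_def)
  show "qint_exists q b J h \<longleftrightarrow> qint_exists q b J h'"
    using I R by (cases J) auto
qed

end

theory Submission
  imports Defs "HOL-Analysis.Convex"
begin

text \<open>
  The three kinds of q-integral are handled alike: each is a positive linear functional, that is,
  additive, homogeneous and monotone on the functions whose integral exists.  For any such
  functional, a pointwise inequality in two independent variables \<open>x\<close>, \<open>y\<close>,
  \[ p(x)\, r(y) \le c\, u(x)\, v(y) + d\, s(x)\, t(y), \]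
  may be integrated first in \<open>x\<close> and then in \<open>y\<close>; the result is the same inequality between
  products of integrals (\<open>J_q_tensor_le\<close>).

  With \<open>F = \<bar>f\<bar>\<close> and \<open>G = \<bar>g\<bar>\<close>, the three claims come in this way from Young's inequality
  \<open>A * B \<le> A powr \<alpha> / \<alpha> + B powr \<beta> / \<beta>\<close>, in which \<open>A\<close> and \<open>B\<close> each mix the two variables:
  \<^item> \<open>A = F x * G y powr (2/\<alpha>)\<close> and \<open>B = G x * F y powr (2/\<beta>)\<close> for (i);
  \<^item> \<open>A = F x powr (2/\<alpha>) * G y powr (\<beta>/\<alpha>)\<close> and \<open>B = G x powr (2/\<beta>) * F y powr (\<alpha>/\<beta>)\<close> for (ii),
    where \<open>\<alpha>/\<beta> = \<alpha> - 1\<close> and \<open>\<beta>/\<alpha> = \<beta> - 1\<close>;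
  \<^item> \<open>A = F x powr (2/\<alpha>) * G y\<close> and \<open>B = G x * F y powr (2/\<beta>)\<close> for (iii).
\<close>

lemma qint_exists_add:
  assumes "qint_exists q b J h" "qint_exists q b J h'"
  shows "qint_exists q b J (\<lambda>x. h x + h' x)"
  using assms by (cases J) (auto simp: distrib_right intro: summable_add)

lemma qint_exists_cmult:
  assumes "qint_exists q b J h"
  shows "qint_exists q b J (\<lambda>x. c * h x)"
  using assms by (cases J) (auto simp: mult.assoc intro: summable_mult)

lemma J_q_add:
  assumes "qint_exists q b J h" "qint_exists q b J h'"
  shows "J_q q b J (\<lambda>x. h x + h' x) = J_q q b J h + J_q q b J h'"
  using assms
  by (cases J)
     (auto simp: G_q_def I_q_def R_q_def distrib_left distrib_right sum.distrib suminf_add[symmetric])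

lemma J_q_cmult:
  assumes "qint_exists q b J h"
  shows "J_q q b J (\<lambda>x. c * h x) = c * J_q q b J h"
  using assms
  by (cases J)
     (auto simp: G_q_def I_q_def R_q_def mult.assoc suminf_mult sum_distrib_left[symmetric])

lemma J_q_mono:
  assumes "0 < q" "q < 1" "admissible b J"
    and "qint_exists q b J h" "qint_exists q b J h'"
    and le: "\<And>x. h x \<le> h' x"
  shows "J_q q b J h \<le> J_q q b J h'"
  using assms
  by (cases J)
     (auto simp: G_q_def I_q_def R_q_def intro!: mult_left_mono sum_mono suminf_le mult_right_mono)

lemma J_q_tensor_le:
  assumes adm: "0 < q" "q < 1" "admissible b J"
    and ex: "qint_exists q b J p" "qint_exists q b J r" "qint_exists q b J u"
      "qint_exists q b J v" "qint_exists q b J s" "qint_exists q b J t"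
    and le: "\<And>x y. p x * r y \<le> c * (u x * v y) + d * (s x * t y)"
  shows "J_q q b J p * J_q q b J r
    \<le> c * (J_q q b J u * J_q q b J v) + d * (J_q q b J s * J_q q b J t)"
proof -
  note ops = qint_exists_add qint_exists_cmult
  have inner: "J_q q b J p * r y \<le> (c * J_q q b J u) * v y + (d * J_q q b J s) * t y" for y
  proof -
    have "J_q q b J (\<lambda>x. r y * p x) \<le> J_q q b J (\<lambda>x. (c * v y) * u x + (d * t y) * s x)"
      using adm ex le[of _ y] by (intro J_q_mono ops) (simp_all add: ac_simps)
    then have "r y * J_q q b J p \<le> (c * v y) * J_q q b J u + (d * t y) * J_q q b J s"
      using ex by (simp add: J_q_add J_q_cmult ops)
    then show ?thesis
      by (simp add: ac_simps)
  qed
  have "J_q q b J (\<lambda>y. J_q q b J p * r y)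
    \<le> J_q q b J (\<lambda>y. (c * J_q q b J u) * v y + (d * J_q q b J s) * t y)"
    using adm ex inner by (intro J_q_mono ops)
  then show ?thesis
    using ex by (simp add: J_q_add J_q_cmult ops mult.assoc)
qed

theorem theorem6p2:
  fixes q b \<alpha> \<beta> :: real and J :: qint_kind and f g :: "real \<Rightarrow> real"
  assumes "0 < q" and "q < 1"
    and "admissible b J"
    and "\<alpha> > 1" and "\<beta> > 1" and "1 / \<alpha> + 1 / \<beta> = 1"
    and "qint_exists q b J (\<lambda>x. \<bar>f x\<bar> powr \<alpha>)"
    and "qint_exists q b J (\<lambda>x. \<bar>g x\<bar> powr \<beta>)"
    and "qint_exists q b J (\<lambda>x. \<bar>f x\<bar> ^ 2)"
    and "qint_exists q b J (\<lambda>x. \<bar>g x\<bar> ^ 2)"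
    and "qint_exists q b J (\<lambda>x. \<bar>f x * g x\<bar>)"
    and "qint_exists q b J (\<lambda>x. \<bar>f x\<bar> powr (2 / \<beta>) * \<bar>g x\<bar> powr (2 / \<alpha>))"
    and "qint_exists q b J (\<lambda>x. \<bar>f x\<bar> powr (2 / \<alpha>) * \<bar>g x\<bar> powr (2 / \<beta>))"
    and "qint_exists q b J (\<lambda>x. \<bar>f x\<bar> powr (\<alpha> - 1) * \<bar>g x\<bar> powr (\<beta> - 1))"
    and "qint_exists q b J (\<lambda>x. 1 / \<alpha> * \<bar>g x\<bar> powr \<alpha> + 1 / \<beta> * \<bar>g x\<bar> powr \<beta>)"
    and "qint_exists q b J (\<lambda>x. \<bar>f x\<bar> powr (2 / \<alpha>) * \<bar>g x\<bar>)"
    and "qint_exists q b J (\<lambda>x. \<bar>f x\<bar> powr (2 / \<beta>) * \<bar>g x\<bar>)"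
  shows
    "(1 / \<alpha> * J_q q b J (\<lambda>x. \<bar>f x\<bar> powr \<alpha>) * J_q q b J (\<lambda>x. \<bar>g x\<bar> ^ 2)
        + 1 / \<beta> * J_q q b J (\<lambda>x. \<bar>f x\<bar> ^ 2) * J_q q b J (\<lambda>x. \<bar>g x\<bar> powr \<beta>)
      \<ge> J_q q b J (\<lambda>x. \<bar>f x * g x\<bar>)
        * J_q q b J (\<lambda>x. \<bar>f x\<bar> powr (2 / \<beta>) * \<bar>g x\<bar> powr (2 / \<alpha>))) \<and>
     (1 / \<alpha> * J_q q b J (\<lambda>x. \<bar>f x\<bar> ^ 2) * J_q q b J (\<lambda>x. \<bar>g x\<bar> powr \<beta>)
        + 1 / \<beta> * J_q q b J (\<lambda>x. \<bar>f x\<bar> powr \<alpha>) * J_q q b J (\<lambda>x. \<bar>g x\<bar> ^ 2)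
      \<ge> J_q q b J (\<lambda>x. \<bar>f x\<bar> powr (2 / \<alpha>) * \<bar>g x\<bar> powr (2 / \<beta>))
        * J_q q b J (\<lambda>x. \<bar>f x\<bar> powr (\<alpha> - 1) * \<bar>g x\<bar> powr (\<beta> - 1))) \<and>
     (J_q q b J (\<lambda>x. \<bar>f x\<bar> ^ 2)
        * J_q q b J (\<lambda>x. 1 / \<alpha> * \<bar>g x\<bar> powr \<alpha> + 1 / \<beta> * \<bar>g x\<bar> powr \<beta>)
      \<ge> J_q q b J (\<lambda>x. \<bar>f x\<bar> powr (2 / \<alpha>) * \<bar>g x\<bar>)
        * J_q q b J (\<lambda>x. \<bar>f x\<bar> powr (2 / \<beta>) * \<bar>g x\<bar>))"
proof -
  have pos: "\<alpha> > 0" "\<beta> > 0" using assms(4,5) by auto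
  have conj: "\<alpha> / \<beta> = \<alpha> - 1" "\<beta> / \<alpha> = \<beta> - 1"
    using assms(6) pos by (simp_all add: field_simps)
  have young: "A * B \<le> 1 / \<alpha> * A powr \<alpha> + 1 / \<beta> * B powr \<beta>" if "A \<ge> 0" "B \<ge> 0" for A B
    using Youngs_inequality[of \<alpha> \<beta> A B] assms(4-6) that by simp
  have pw: "(\<bar>z\<bar> powr (e / c)) powr c = \<bar>z\<bar> powr e" if "c > 0" for z c e :: real
    using that by (simp add: powr_powr)
  have sq: "\<bar>z\<bar> powr 2 = \<bar>z\<bar> ^ 2" for z :: real
    by simp
  note simps = powr_mult pw pos sq ac_simps
  note tensor = J_q_tensor_le[OF assms(1-3)]
  have "J_q q b J (\<lambda>x. \<bar>f x * g x\<bar>)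
      * J_q q b J (\<lambda>x. \<bar>f x\<bar> powr (2 / \<beta>) * \<bar>g x\<bar> powr (2 / \<alpha>))
    \<le> 1 / \<alpha> * (J_q q b J (\<lambda>x. \<bar>f x\<bar> powr \<alpha>) * J_q q b J (\<lambda>x. \<bar>g x\<bar> ^ 2))
      + 1 / \<beta> * (J_q q b J (\<lambda>x. \<bar>g x\<bar> powr \<beta>) * J_q q b J (\<lambda>x. \<bar>f x\<bar> ^ 2))"
  proof (rule tensor)
    show "\<bar>f x * g x\<bar> * (\<bar>f y\<bar> powr (2 / \<beta>) * \<bar>g y\<bar> powr (2 / \<alpha>))
      \<le> 1 / \<alpha> * (\<bar>f x\<bar> powr \<alpha> * \<bar>g y\<bar> ^ 2) + 1 / \<beta> * (\<bar>g x\<bar> powr \<beta> * \<bar>f y\<bar> ^ 2)" for x y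
      using young[of "\<bar>f x\<bar> * \<bar>g y\<bar> powr (2 / \<alpha>)" "\<bar>g x\<bar> * \<bar>f y\<bar> powr (2 / \<beta>)"]
      by (simp add: simps abs_mult)
  qed (use assms in auto)
  moreover have "J_q q b J (\<lambda>x. \<bar>f x\<bar> powr (2 / \<alpha>) * \<bar>g x\<bar> powr (2 / \<beta>))
      * J_q q b J (\<lambda>x. \<bar>f x\<bar> powr (\<alpha> - 1) * \<bar>g x\<bar> powr (\<beta> - 1))
    \<le> 1 / \<alpha> * (J_q q b J (\<lambda>x. \<bar>f x\<bar> ^ 2) * J_q q b J (\<lambda>x. \<bar>g x\<bar> powr \<beta>))
      + 1 / \<beta> * (J_q q b J (\<lambda>x. \<bar>g x\<bar> ^ 2) * J_q q b J (\<lambda>x. \<bar>f x\<bar> powr \<alpha>))"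
  proof (rule tensor)
    show "\<bar>f x\<bar> powr (2 / \<alpha>) * \<bar>g x\<bar> powr (2 / \<beta>) * (\<bar>f y\<bar> powr (\<alpha> - 1) * \<bar>g y\<bar> powr (\<beta> - 1))
      \<le> 1 / \<alpha> * (\<bar>f x\<bar> ^ 2 * \<bar>g y\<bar> powr \<beta>) + 1 / \<beta> * (\<bar>g x\<bar> ^ 2 * \<bar>f y\<bar> powr \<alpha>)" for x y
      using young[of "\<bar>f x\<bar> powr (2 / \<alpha>) * \<bar>g y\<bar> powr (\<beta> / \<alpha>)"
          "\<bar>g x\<bar> powr (2 / \<beta>) * \<bar>f y\<bar> powr (\<alpha> / \<beta>)"]
      unfolding conj[symmetric] by (simp add: simps)
  qed (use assms in auto)
  moreover have "J_q q b J (\<lambda>x. \<bar>f x\<bar> powr (2 / \<alpha>) * \<bar>g x\<bar>)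
      * J_q q b J (\<lambda>x. \<bar>f x\<bar> powr (2 / \<beta>) * \<bar>g x\<bar>)
    \<le> J_q q b J (\<lambda>x. \<bar>f x\<bar> ^ 2)
      * J_q q b J (\<lambda>x. 1 / \<alpha> * \<bar>g x\<bar> powr \<alpha> + 1 / \<beta> * \<bar>g x\<bar> powr \<beta>)"
  proof -
    let ?H = "\<lambda>x. 1 / \<alpha> * \<bar>g x\<bar> powr \<alpha> + 1 / \<beta> * \<bar>g x\<bar> powr \<beta>"
    \<comment> \<open>The existence of the integral of \<open>\<bar>g\<bar> powr \<alpha>\<close> is not assumed; it follows by subtraction.\<close>
    have "qint_exists q b J (\<lambda>x. \<alpha> * (?H x + (- 1 / \<beta>) * \<bar>g x\<bar> powr \<beta>))"
      by (intro qint_exists_add qint_exists_cmult assms)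
    then have ex: "qint_exists q b J (\<lambda>x. \<bar>g x\<bar> powr \<alpha>)"
      using pos by simp
    have "J_q q b J (\<lambda>x. \<bar>f x\<bar> powr (2 / \<alpha>) * \<bar>g x\<bar>)
        * J_q q b J (\<lambda>x. \<bar>f x\<bar> powr (2 / \<beta>) * \<bar>g x\<bar>)
      \<le> 1 / \<alpha> * (J_q q b J (\<lambda>x. \<bar>f x\<bar> ^ 2) * J_q q b J (\<lambda>x. \<bar>g x\<bar> powr \<alpha>))
        + 1 / \<beta> * (J_q q b J (\<lambda>x. \<bar>g x\<bar> powr \<beta>) * J_q q b J (\<lambda>x. \<bar>f x\<bar> ^ 2))"
    proof (rule tensor)
      show "\<bar>f x\<bar> powr (2 / \<alpha>) * \<bar>g x\<bar> * (\<bar>f y\<bar> powr (2 / \<beta>) * \<bar>g y\<bar>)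
        \<le> 1 / \<alpha> * (\<bar>f x\<bar> ^ 2 * \<bar>g y\<bar> powr \<alpha>) + 1 / \<beta> * (\<bar>g x\<bar> powr \<beta> * \<bar>f y\<bar> ^ 2)" for x y
        using young[of "\<bar>f x\<bar> powr (2 / \<alpha>) * \<bar>g y\<bar>" "\<bar>g x\<bar> * \<bar>f y\<bar> powr (2 / \<beta>)"]
        by (simp add: simps)
    qed (use assms ex in auto)
    moreover have "J_q q b J ?H = 1 / \<alpha> * J_q q b J (\<lambda>x. \<bar>g x\<bar> powr \<alpha>)
        + 1 / \<beta> * J_q q b J (\<lambda>x. \<bar>g x\<bar> powr \<beta>)"
      by (simp only: J_q_add J_q_cmult qint_exists_cmult ex assms(8))
    ultimately show ?thesis
      by (simp add: algebra_simps)
  qed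
  ultimately show ?thesis
    by (simp add: ac_simps)
qed

end
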